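(* Let $p\ge 0$ be an integer, let $(X_i,Y_i)$, $i=1,\dots,n$, be the data, and let $x$ be a grid point in the range of the $X_i$'s. Let $\hat\beta=(\hat\beta_0,\dots,\hat\beta_p)^T$ be the local polynomial fit of degree $p$ at $x$ with kernel $K$ and bandwidth $h$, and let $SST(x;h)$, $SSE_p(x;h)$, $SSR_p(x;h)$ be the local sums of squares defined in the context. Then the following exact, finite-sample ANOVA decomposition holds: $$SST(x;h)=SSE_p(x;h)+SSR_p(x;h).$$ In addition, for local linear regression ($p=1$), with $\hat\beta_1$ the fitted local slope at $x$, $SSE_1(x;h)$ is related to the weighted least squared error of the Nadaraya--Watson estimator (the case $p=0$) by $$SSE_1(x;h)=\frac{n^{-1}\sum_{i=1}^n (Y_i-\hat m_{NW}(x))^2K_h(X_i-x)}{\hat f(x;h)}-\hat\beta_1^2\,\frac{n^{-1}\sum_{i=1}^n (X_i-\bar X_k)^2K_h(X_i-x)}{\hat f(x;h)},$$ where $\hat m_{NW}(x)=n^{-1}\sum_{i=1}^n K_h(X_i-x)Y_i/\hat f(x;h)$ and $\bar X_k=n^{-1}\sum_{i=1}^n X_iK_h(X_i-x)/\hat f(x;h)$.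
   Context: $(X_i,Y_i)$, $i=1,\dots,n$, are real-valued data; $\bar Y=n^{-1}\sum_{i=1}^n Y_i$. $K$ is a nonnegative weight function (kernel), $h>0$ is the bandwidth, and $K_h(\cdot)=K(\cdot/h)/h$. The kernel density estimator is $\hat f(x;h)=n^{-1}\sum_{i=1}^n K_h(X_i-x)$ (the quantities below are defined when it is nonzero). The local polynomial fit of degree $p$ at $x$ is the solution $\hat\beta=(\hat\beta_0,\dots,\hat\beta_p)^T$ (depending on $x$ and $h$) of $$\min_{\beta}\; n^{-1}\sum_{i=1}^n\Big(Y_i-\sum_{j=0}^p\beta_j(X_i-x)^j\Big)^2K_h(X_i-x).$$ The local sums of squares are $$SSE_p(x;h)=\frac{n^{-1}\sum_{i=1}^n\big(Y_i-\sum_{j=0}^p\hat\beta_j(X_i-x)^j\big)^2K_h(X_i-x)}{\hat f(x;h)},$$ $$SST(x;h)=\frac{n^{-1}\sum_{i=1}^n(Y_i-\bar Y)^2K_h(X_i-x)}{\hat f(x;h)},$$ $$SSR_p(x;h)=\frac{n^{-1}\sum_{i=1}^n\big(\sum_{j=0}^p\hat\beta_j(X_i-x)^j-\bar Y\big)^2K_h(X_i-x)}{\hat f(x;h)}.$$ *)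

theory Defs
  imports Complex_Main
begin

(* The data are (X i, Y i) for i in {1..n}. *)

definition sample_mean :: "nat \<Rightarrow> (nat \<Rightarrow> real) \<Rightarrow> real" where
  "sample_mean n Z = (\<Sum>i = 1..n. Z i) / real n"

definition scaled_kernel :: "(real \<Rightarrow> real) \<Rightarrow> real \<Rightarrow> real \<Rightarrow> real" where
  "scaled_kernel K h u = K (u / h) / h"

definition kde :: "nat \<Rightarrow> (nat \<Rightarrow> real) \<Rightarrow> (real \<Rightarrow> real) \<Rightarrow> real \<Rightarrow> real \<Rightarrow> real" where
  "kde n X K h x = (\<Sum>i = 1..n. scaled_kernel K h (X i - x)) / real n"

(* The value at t of the polynomial of degree p, centred at x, with
   coefficients \<beta> 0, ..., \<beta> p; the values \<beta> j with j > p play no role. *)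
definition local_poly :: "nat \<Rightarrow> (nat \<Rightarrow> real) \<Rightarrow> real \<Rightarrow> real \<Rightarrow> real" where
  "local_poly p \<beta> x t = (\<Sum>j = 0..p. \<beta> j * (t - x) ^ j)"

definition local_criterion ::
  "nat \<Rightarrow> (nat \<Rightarrow> real) \<Rightarrow> (nat \<Rightarrow> real) \<Rightarrow> (real \<Rightarrow> real) \<Rightarrow> real \<Rightarrow> real \<Rightarrow> nat \<Rightarrow> (nat \<Rightarrow> real) \<Rightarrow> real" where
  "local_criterion n X Y K h x p \<beta> =
     (\<Sum>i = 1..n. (Y i - local_poly p \<beta> x (X i))\<^sup>2 * scaled_kernel K h (X i - x)) / real n"

(* A predicate rather than a function: when fewer than p + 1 distinct X i carry
   positive weight, the least squares problem has several solutions. *)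
definition is_local_poly_fit ::
  "nat \<Rightarrow> (nat \<Rightarrow> real) \<Rightarrow> (nat \<Rightarrow> real) \<Rightarrow> (real \<Rightarrow> real) \<Rightarrow> real \<Rightarrow> real \<Rightarrow> nat \<Rightarrow> (nat \<Rightarrow> real) \<Rightarrow> bool" where
  "is_local_poly_fit n X Y K h x p \<beta> \<longleftrightarrow>
     is_arg_min (local_criterion n X Y K h x p) (\<lambda>_. True) \<beta>"

definition local_SSE ::
  "nat \<Rightarrow> (nat \<Rightarrow> real) \<Rightarrow> (nat \<Rightarrow> real) \<Rightarrow> (real \<Rightarrow> real) \<Rightarrow> real \<Rightarrow> real \<Rightarrow> nat \<Rightarrow> (nat \<Rightarrow> real) \<Rightarrow> real" where
  "local_SSE n X Y K h x p \<beta> =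
     ((\<Sum>i = 1..n. (Y i - local_poly p \<beta> x (X i))\<^sup>2 * scaled_kernel K h (X i - x)) / real n)
       / kde n X K h x"

definition local_SST ::
  "nat \<Rightarrow> (nat \<Rightarrow> real) \<Rightarrow> (nat \<Rightarrow> real) \<Rightarrow> (real \<Rightarrow> real) \<Rightarrow> real \<Rightarrow> real \<Rightarrow> real" where
  "local_SST n X Y K h x =
     ((\<Sum>i = 1..n. (Y i - sample_mean n Y)\<^sup>2 * scaled_kernel K h (X i - x)) / real n)
       / kde n X K h x"

definition local_SSR ::
  "nat \<Rightarrow> (nat \<Rightarrow> real) \<Rightarrow> (nat \<Rightarrow> real) \<Rightarrow> (real \<Rightarrow> real) \<Rightarrow> real \<Rightarrow> real \<Rightarrow> nat \<Rightarrow> (nat \<Rightarrow> real) \<Rightarrow> real" where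
  "local_SSR n X Y K h x p \<beta> =
     ((\<Sum>i = 1..n. (local_poly p \<beta> x (X i) - sample_mean n Y)\<^sup>2 * scaled_kernel K h (X i - x)) / real n)
       / kde n X K h x"

(* The locally weighted average at x of values Z i attached to the design points:
   with Z = Y it is the Nadaraya-Watson estimator, with Z = X the local mean
   of the design points. *)
definition kernel_mean ::
  "nat \<Rightarrow> (nat \<Rightarrow> real) \<Rightarrow> (nat \<Rightarrow> real) \<Rightarrow> (real \<Rightarrow> real) \<Rightarrow> real \<Rightarrow> real \<Rightarrow> real" where
  "kernel_mean n X Z K h x =
     ((\<Sum>i = 1..n. scaled_kernel K h (X i - x) * Z i) / real n) / kde n X K h x"

definition nadaraya_watson ::
  "nat \<Rightarrow> (nat \<Rightarrow> real) \<Rightarrow> (nat \<Rightarrow> real) \<Rightarrow> (real \<Rightarrow> real) \<Rightarrow> real \<Rightarrow> real \<Rightarrow> real" where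
  "nadaraya_watson n X Y K h x = kernel_mean n X Y K h x"

definition local_design_mean ::
  "nat \<Rightarrow> (nat \<Rightarrow> real) \<Rightarrow> (real \<Rightarrow> real) \<Rightarrow> real \<Rightarrow> real \<Rightarrow> real" where
  "local_design_mean n X K h x = kernel_mean n X X K h x"

end

theory Submission
  imports Defs
begin

text \<open>
  Write $w_i = K_h(X_i - x)$ and $\langle u, v\rangle = \sum_i u_i v_i w_i$. A local polynomial fit is an
  orthogonal projection of $Y$, in this semi-inner product, onto the space of polynomials of degree
  at most $p$ in $X_i - x$; so its residuals are orthogonal to every element of that space
  (\<open>fit_residuals_orthogonal\<close>). Each of the three claims is then an instance of Pythagoras'
  theorem (\<open>weighted_pythagoras\<close>), applied to a decomposition of $Y_i - c$ into a residual and a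
  polynomial of admissible degree:

  \<^item> For the ANOVA identity $c = \bar Y$, and the second summand is the fit minus $\bar Y$. It lies
    in the space of fitted functions because the constants do. Any other constant would serve equally
    well, which is why the global mean may appear in a local identity.
  \<^item> For degree zero, $Y_i - b = (Y_i - m) + (m - b)$ with $m$ the Nadaraya--Watson estimator, a
    weighted mean. The criterion exceeds its value at $m$ by a positive multiple of $(m - b)^2$,
    hence $m$ is the unique minimiser.
  \<^item> For degree one, orthogonality of the residuals to the constants says that the fitted line passes
    through the point $(\bar X_k, m)$ of weighted means. Hence $Y_i - m$ is the residual plus
    $\hat\beta_1 (X_i - \bar X_k)$, and Pythagoras gives the relation between the two errors.
\<close>

section \<open>Weighted sums of squares\<close>

lemma weighted_pythagoras:
  fixes u v w :: "'a \<Rightarrow> real"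
  assumes "(\<Sum>i\<in>A. u i * v i * w i) = 0"
  shows "(\<Sum>i\<in>A. (u i + v i)\<^sup>2 * w i) = (\<Sum>i\<in>A. (u i)\<^sup>2 * w i) + (\<Sum>i\<in>A. (v i)\<^sup>2 * w i)"
proof -
  have "(\<Sum>i\<in>A. (u i + v i)\<^sup>2 * w i)
      = (\<Sum>i\<in>A. (u i)\<^sup>2 * w i) + (\<Sum>i\<in>A. (v i)\<^sup>2 * w i) + 2 * (\<Sum>i\<in>A. u i * v i * w i)"
    unfolding sum_distrib_left sum.distrib[symmetric]
    by (rule sum.cong) (simp_all add: power2_eq_square algebra_simps)
  with assms show ?thesis by simp
qed

text \<open>The first-order condition for a minimum along the line through \<open>u\<close> in direction \<open>v\<close>, obtained
  without differentiating: along that line the weighted sum of squares is a quadratic in \<open>t\<close> with linear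
  coefficient $-2\langle u, v\rangle$, and a small step of the sign of $\langle u, v\rangle$ would
  decrease it.\<close>

lemma orthogonal_if_minimal_along_line:
  fixes u v w :: "'a \<Rightarrow> real"
  assumes min: "\<And>t. (\<Sum>i\<in>A. (u i)\<^sup>2 * w i) \<le> (\<Sum>i\<in>A. (u i - t * v i)\<^sup>2 * w i)"
  shows "(\<Sum>i\<in>A. u i * v i * w i) = 0"
proof (rule ccontr)
  define B where "B = (\<Sum>i\<in>A. u i * v i * w i)"
  define G where "G = (\<Sum>i\<in>A. (v i)\<^sup>2 * w i)"
  assume "(\<Sum>i\<in>A. u i * v i * w i) \<noteq> 0"
  then have "B \<noteq> 0" by (simp add: B_def)
  have quadratic: "2 * t * B \<le> t\<^sup>2 * G" for t
  proof -
    have "(\<Sum>i\<in>A. (u i - t * v i)\<^sup>2 * w i) = (\<Sum>i\<in>A. (u i)\<^sup>2 * w i) + t\<^sup>2 * G - 2 * t * B"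
      unfolding B_def G_def sum_distrib_left sum.distrib[symmetric] sum_subtractf[symmetric]
      by (rule sum.cong) (simp_all add: power2_eq_square algebra_simps)
    with min[of t] show ?thesis by simp
  qed
  \<comment> \<open>The step \<open>B / d\<close> is so short that the quadratic term cannot compensate the linear one; adding
    one keeps \<open>d\<close> nonzero when \<open>G\<close> vanishes.\<close>
  define d where "d = \<bar>G\<bar> + 1"
  have d: "d > 0" "G < 2 * d" by (simp_all add: d_def)
  have "2 * d * B\<^sup>2 \<le> G * B\<^sup>2"
    using quadratic[of "B / d"] d(1) by (simp add: field_simps power2_eq_square)
  moreover have "G * B\<^sup>2 < 2 * d * B\<^sup>2"
    using d(2) \<open>B \<noteq> 0\<close> by (intro mult_strict_right_mono) simp_all
  ultimately show False by simp
qed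

section \<open>Local polynomials\<close>

lemma local_poly_add_scaled:
  "local_poly p (\<lambda>j. \<beta> j + c * \<gamma> j) x t = local_poly p \<beta> x t + c * local_poly p \<gamma> x t"
  unfolding local_poly_def sum_distrib_left sum.distrib[symmetric]
  by (rule sum.cong) (simp_all add: algebra_simps)

lemma local_poly_const: "local_poly p (\<lambda>j. if j = 0 then c else 0) x t = c"
proof -
  have "local_poly p (\<lambda>j. if j = 0 then c else 0) x t = (\<Sum>j = 0..p. if j = 0 then c else 0)"
    unfolding local_poly_def by (rule sum.cong) auto
  then show ?thesis by simp
qed

lemma local_poly_0: "local_poly 0 \<beta> x t = \<beta> 0"
  by (simp add: local_poly_def)

lemma local_poly_1: "local_poly 1 \<beta> x t = \<beta> 0 + \<beta> 1 * (t - x)"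
  by (simp add: local_poly_def)

section \<open>Kernel-weighted means\<close>

text \<open>Characterising a mean by the vanishing of the weighted deviations puts the quotient
  \<open>kernel_mean\<close> in the form of an orthogonality to the constants, as in the normal equations.\<close>

lemma kernel_mean_eq_iff:
  assumes "kde n X K h x \<noteq> 0"
  shows "kernel_mean n X Z K h x = a \<longleftrightarrow> (\<Sum>i = 1..n. (Z i - a) * scaled_kernel K h (X i - x)) = 0"
proof -
  have n: "real n \<noteq> 0" using assms by (auto simp: kde_def)
  have W: "(\<Sum>i = 1..n. scaled_kernel K h (X i - x)) = real n * kde n X K h x"
    using n by (simp add: kde_def)
  have "(\<Sum>i = 1..n. (Z i - a) * scaled_kernel K h (X i - x))
      = (\<Sum>i = 1..n. scaled_kernel K h (X i - x) * Z i) - a * (real n * kde n X K h x)"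
    unfolding W[symmetric] sum_distrib_left sum_subtractf[symmetric]
    by (rule sum.cong) (simp_all add: algebra_simps)
  then show ?thesis
    using assms n unfolding kernel_mean_def by (auto simp: field_simps)
qed

section \<open>Local polynomial fits\<close>

lemma is_local_poly_fit_iff_le:
  assumes "n \<ge> 1"
  shows "is_local_poly_fit n X Y K h x p \<beta> \<longleftrightarrow>
    (\<forall>\<gamma>. (\<Sum>i = 1..n. (Y i - local_poly p \<beta> x (X i))\<^sup>2 * scaled_kernel K h (X i - x))
        \<le> (\<Sum>i = 1..n. (Y i - local_poly p \<gamma> x (X i))\<^sup>2 * scaled_kernel K h (X i - x)))"
  using assms
  by (auto simp: is_local_poly_fit_def is_arg_min_def local_criterion_def not_less
      divide_le_cancel)

text \<open>The normal equations. They hold for every solution of the least squares problem,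
  unique or not, because only the minimality along lines through the solution enters.\<close>

lemma fit_residuals_orthogonal:
  assumes "n \<ge> 1" and fit: "is_local_poly_fit n X Y K h x p \<beta>"
  shows "(\<Sum>i = 1..n. (Y i - local_poly p \<beta> x (X i)) * local_poly p \<gamma> x (X i)
            * scaled_kernel K h (X i - x)) = 0"
proof (rule orthogonal_if_minimal_along_line)
  fix t
  have "Y i - local_poly p (\<lambda>j. \<beta> j + t * \<gamma> j) x (X i)
      = Y i - local_poly p \<beta> x (X i) - t * local_poly p \<gamma> x (X i)" for i
    by (simp add: local_poly_add_scaled)
  with fit[unfolded is_local_poly_fit_iff_le[OF \<open>n \<ge> 1\<close>], rule_format, of "\<lambda>j. \<beta> j + t * \<gamma> j"]
  show "(\<Sum>i = 1..n. (Y i - local_poly p \<beta> x (X i))\<^sup>2 * scaled_kernel K h (X i - x))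
      \<le> (\<Sum>i = 1..n. (Y i - local_poly p \<beta> x (X i) - t * local_poly p \<gamma> x (X i))\<^sup>2
            * scaled_kernel K h (X i - x))"
    by simp
qed

text \<open>The common form of the ANOVA identity and of the local linear identity: \<open>c i\<close> may be any
  centring that differs from the fit, at the design points, by a local polynomial
  of degree at most \<open>p\<close>.\<close>

lemma fit_sum_of_squares_decomposition:
  assumes "n \<ge> 1" and "is_local_poly_fit n X Y K h x p \<beta>"
    and \<gamma>: "\<And>i. local_poly p \<beta> x (X i) - c i = local_poly p \<gamma> x (X i)"
  shows "(\<Sum>i = 1..n. (Y i - c i)\<^sup>2 * scaled_kernel K h (X i - x))
       = (\<Sum>i = 1..n. (Y i - local_poly p \<beta> x (X i))\<^sup>2 * scaled_kernel K h (X i - x))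
       + (\<Sum>i = 1..n. (local_poly p \<beta> x (X i) - c i)\<^sup>2 * scaled_kernel K h (X i - x))"
  using weighted_pythagoras[OF fit_residuals_orthogonal[OF assms(1,2), of \<gamma>]]
  unfolding \<gamma>[symmetric] by simp

lemma local_anova:
  assumes "n \<ge> 1" and "is_local_poly_fit n X Y K h x p \<beta>"
  shows "local_SST n X Y K h x = local_SSE n X Y K h x p \<beta> + local_SSR n X Y K h x p \<beta>"
proof -
  let ?c = "sample_mean n Y"
  have "local_poly p \<beta> x (X i) - ?c
      = local_poly p (\<lambda>j. \<beta> j + (-1) * (if j = 0 then ?c else 0)) x (X i)" for i
    by (simp only: local_poly_add_scaled local_poly_const)
  from fit_sum_of_squares_decomposition[OF assms this]
  show ?thesis
    by (simp add: local_SST_def local_SSE_def local_SSR_def add_divide_distrib)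
qed

text \<open>The density estimate is the total weight divided by \<open>n\<close>. A nonnegative kernel thus makes a
  nonzero total weight positive, and then the excess of the criterion over its value at the weighted
  mean is positive everywhere else.\<close>

lemma local_constant_fit_iff:
  assumes "n \<ge> 1" and K_nonneg: "\<And>u. K u \<ge> 0" and "h > 0" and kde: "kde n X K h x \<noteq> 0"
  shows "is_local_poly_fit n X Y K h x 0 \<beta> \<longleftrightarrow> \<beta> 0 = nadaraya_watson n X Y K h x"
proof -
  let ?w = "\<lambda>i. scaled_kernel K h (X i - x)"
  define m where "m = nadaraya_watson n X Y K h x"
  define S where "S b = (\<Sum>i = 1..n. (Y i - b)\<^sup>2 * ?w i)" for b
  define W where "W = (\<Sum>i = 1..n. ?w i)"
  have "W \<ge> 0"
    unfolding W_def scaled_kernel_def using K_nonneg \<open>h > 0\<close> by (simp add: sum_nonneg)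
  moreover have "W \<noteq> 0" using kde by (auto simp: W_def kde_def)
  ultimately have "W > 0" by simp
  have centred: "(\<Sum>i = 1..n. (Y i - m) * ?w i) = 0"
    using kernel_mean_eq_iff[OF kde, of Y m] by (simp add: m_def nadaraya_watson_def)
  have excess: "S b = S m + (m - b)\<^sup>2 * W" for b
  proof -
    have "(\<Sum>i = 1..n. (Y i - m) * (m - b) * ?w i) = (m - b) * (\<Sum>i = 1..n. (Y i - m) * ?w i)"
      by (simp add: sum_distrib_left mult_ac)
    then have "(\<Sum>i = 1..n. (Y i - m) * (m - b) * ?w i) = 0" by (simp only: centred)
    from weighted_pythagoras[OF this] show ?thesis
      by (simp add: S_def W_def sum_distrib_left)
  qed
  have "is_local_poly_fit n X Y K h x 0 \<beta> \<longleftrightarrow> (\<forall>\<gamma> :: nat \<Rightarrow> real. S (\<beta> 0) \<le> S (\<gamma> 0))"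
    unfolding is_local_poly_fit_iff_le[OF \<open>n \<ge> 1\<close>] local_poly_0 S_def by (rule refl)
  also have "\<dots> \<longleftrightarrow> \<beta> 0 = m"
  proof
    assume "\<forall>\<gamma> :: nat \<Rightarrow> real. S (\<beta> 0) \<le> S (\<gamma> 0)"
    then have "S (\<beta> 0) \<le> S m" by (rule allE[of _ "\<lambda>_. m"]) simp
    then have "(m - \<beta> 0)\<^sup>2 * W \<le> 0" by (simp add: excess[of "\<beta> 0"])
    then show "\<beta> 0 = m" using \<open>W > 0\<close> by (auto simp: mult_le_0_iff)
  next
    assume "\<beta> 0 = m"
    then show "\<forall>\<gamma> :: nat \<Rightarrow> real. S (\<beta> 0) \<le> S (\<gamma> 0)"
      using \<open>W > 0\<close> by (simp add: excess[of "_ 0"])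
  qed
  finally show ?thesis by (simp add: m_def)
qed

text \<open>The normal equation for the constants says that the residuals have weighted mean zero, that is,
  the fitted values have the same weighted mean as the responses; and the weighted mean of a linear
  function is its value at the weighted mean.\<close>

lemma local_linear_fit_at_means:
  assumes "n \<ge> 1" and kde: "kde n X K h x \<noteq> 0"
    and fit: "is_local_poly_fit n X Y K h x 1 \<beta>"
  shows "nadaraya_watson n X Y K h x = \<beta> 0 + \<beta> 1 * (local_design_mean n X K h x - x)"
proof -
  let ?w = "\<lambda>i. scaled_kernel K h (X i - x)"
  define a where "a = local_design_mean n X K h x"
  have design: "(\<Sum>i = 1..n. (X i - a) * ?w i) = 0"
    using kernel_mean_eq_iff[OF kde, of X a] by (simp add: a_def local_design_mean_def)
  have resid: "(\<Sum>i = 1..n. (Y i - local_poly 1 \<beta> x (X i)) * ?w i) = 0"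
    using fit_residuals_orthogonal[OF \<open>n \<ge> 1\<close> fit, of "\<lambda>j. if j = 0 then 1 else 0"]
    unfolding local_poly_const by simp
  have "(\<Sum>i = 1..n. (Y i - (\<beta> 0 + \<beta> 1 * (a - x))) * ?w i)
      = (\<Sum>i = 1..n. (Y i - local_poly 1 \<beta> x (X i)) * ?w i) + \<beta> 1 * (\<Sum>i = 1..n. (X i - a) * ?w i)"
    unfolding sum_distrib_left sum.distrib[symmetric] local_poly_1
    by (rule sum.cong) (simp_all add: algebra_simps)
  also have "\<dots> = 0" by (simp only: resid design)
  finally show ?thesis
    using kernel_mean_eq_iff[OF kde, of Y] by (simp add: a_def nadaraya_watson_def)
qed

lemma local_linear_SSE:
  assumes "n \<ge> 1" and kde: "kde n X K h x \<noteq> 0"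
    and fit: "is_local_poly_fit n X Y K h x 1 \<beta>"
  shows "local_SSE n X Y K h x 1 \<beta> =
    ((\<Sum>i = 1..n. (Y i - nadaraya_watson n X Y K h x)\<^sup>2 * scaled_kernel K h (X i - x)) / real n)
      / kde n X K h x
    - (\<beta> 1)\<^sup>2 *
      (((\<Sum>i = 1..n. (X i - local_design_mean n X K h x)\<^sup>2 * scaled_kernel K h (X i - x)) / real n)
        / kde n X K h x)"
proof -
  let ?w = "\<lambda>i. scaled_kernel K h (X i - x)"
  define m where "m = nadaraya_watson n X Y K h x"
  define a where "a = local_design_mean n X K h x"
  have slope: "local_poly 1 \<beta> x (X i) - m = \<beta> 1 * (X i - a)" for i
    using local_linear_fit_at_means[OF assms] unfolding local_poly_1 m_def a_def
    by (simp add: algebra_simps)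
  have "local_poly 1 \<beta> x (X i) - m
      = local_poly 1 (\<lambda>j. \<beta> j + (-1) * (if j = 0 then m else 0)) x (X i)" for i
    by (simp only: local_poly_add_scaled local_poly_const)
  from fit_sum_of_squares_decomposition[OF \<open>n \<ge> 1\<close> fit this]
  have "(\<Sum>i = 1..n. (Y i - m)\<^sup>2 * ?w i)
      = (\<Sum>i = 1..n. (Y i - local_poly 1 \<beta> x (X i))\<^sup>2 * ?w i)
      + (\<beta> 1)\<^sup>2 * (\<Sum>i = 1..n. (X i - a)\<^sup>2 * ?w i)"
    unfolding slope by (simp add: power_mult_distrib sum_distrib_left mult.assoc)
  then show ?thesis
    unfolding local_SSE_def m_def[symmetric] a_def[symmetric]
    by (simp add: add_divide_distrib)
qed

theorem theorem1:
  fixes n :: nat and X Y :: "nat \<Rightarrow> real" and K :: "real \<Rightarrow> real" and h x :: real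
  assumes n_pos: "n \<ge> 1"
    and K_nonneg: "\<And>u. K u \<ge> 0"
    and h_pos: "h > 0"
    and x_range: "x \<in> {Min (X ` {1..n})..Max (X ` {1..n})}"
    and kde_nonzero: "kde n X K h x \<noteq> 0"
  shows "(\<forall>p \<beta>. is_local_poly_fit n X Y K h x p \<beta> \<longrightarrow>
            local_SST n X Y K h x = local_SSE n X Y K h x p \<beta> + local_SSR n X Y K h x p \<beta>)
       \<and> (\<forall>\<beta>. is_local_poly_fit n X Y K h x 0 \<beta> \<longleftrightarrow> \<beta> 0 = nadaraya_watson n X Y K h x)
       \<and> (\<forall>\<beta>. is_local_poly_fit n X Y K h x 1 \<beta> \<longrightarrow>
            local_SSE n X Y K h x 1 \<beta> =
              ((\<Sum>i = 1..n. (Y i - nadaraya_watson n X Y K h x)\<^sup>2 * scaled_kernel K h (X i - x)) / real n)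
                / kde n X K h x
              - (\<beta> 1)\<^sup>2 *
                (((\<Sum>i = 1..n. (X i - local_design_mean n X K h x)\<^sup>2 * scaled_kernel K h (X i - x)) / real n)
                  / kde n X K h x))"
  using local_anova[OF n_pos] local_constant_fit_iff[OF n_pos K_nonneg h_pos kde_nonzero]
    local_linear_SSE[OF n_pos kde_nonzero]
  by blast

end
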